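(* Let $\vec\mu=(\mu_1,\dots,\mu_d)$ satisfy conditions (A), (B), (C) of the context, let $\vec N\in\mathbb N^d$ and let $\vec\kappa\in\mathbb R^d$ satisfy $\kappa_1+\cdots+\kappa_d=1$. Let $\mathcal J_{\vec\kappa,\vec N}$ be the associated self-adjoint Jacobi matrix on the finite tree $\mathcal T_{\vec N}$ with root $O$ and set of vertices $\mathcal V_{\vec N}$. Then for every $Y\in\mathcal V_{\vec N}$ and every $z\in\mathbb C\setminus\sigma(\mathcal J_{\vec\kappa,\vec N})$, the Green's function $G^{(\vec N)}(Y,O,z):=\langle(\mathcal J_{\vec\kappa,\vec N}-z)^{-1}e_O,e_Y\rangle$ is given by $$G^{(\vec N)}(Y,O,z)=-\frac{m_Y^{-1}P_{\Pi(Y)}(z)}{\sum_{j=1}^d\kappa_jP_{\vec N+\vec e_j}(z)}.$$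
   Context: Notation: $\mathbb N=\{1,2,\dots\}$, $\mathbb Z_+=\{0,1,2,\dots\}$; $\vec e_1,\dots,\vec e_d$ is the standard basis of $\mathbb R^d$; $|\vec n|=n_1+\cdots+n_d$. Measures: $\mu_1,\dots,\mu_d$ are positive finite Borel measures on $\mathbb R$ with infinite supports and finite moments. Type II multiple orthogonal polynomial: a nonzero polynomial $P_{\vec n}$ with $\deg P_{\vec n}\le|\vec n|$ and $\int P_{\vec n}(x)x^l\,d\mu_j(x)=0$ for all $j\in\{1,\dots,d\}$, $l\in\{0,\dots,n_j-1\}$. The multi-index $\vec n$ is normal if $P_{\vec n}$ is unique up to a constant factor; then $P_{\vec n}$ is taken monic of degree $|\vec n|$. The vector $\vec\mu$ is perfect if all $\vec n\in\mathbb Z_+^d$ are normal. For perfect $\vec\mu$ there are uniquely determined real $a_{\vec n,j},b_{\vec n,j}$ with $$xP_{\vec n}(x)=P_{\vec n+\vec e_j}(x)+b_{\vec n,j}P_{\vec n}(x)+\sum_{l=1}^d a_{\vec n,l}P_{\vec n-\vec e_l}(x),\quad j\in\{1,\dots,d\},\ \vec n\in\mathbb Z_+^d,$$ where $P_{\vec n-\vec e_l}=0$ and $a_{\vec n,l}=0$ if a component of $\vec n-\vec e_l$ is negative. Conditions: (A) $\vec\mu$ is perfect; (B) $a_{\vec n,j}>0$ whenever $\vec n\in\mathbb Z_+^d$, $n_j>0$; (C) $\sup_{\vec n\in\mathbb N^d,j}a_{\vec n,j}<\infty$ and $\sup_{\vec n\in\mathbb N^d,j}|b_{\vec n,j}|<\infty$.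 Finite tree: $\mathcal T_{\vec N}$ is the finite rooted tree with vertex set $\mathcal V_{\vec N}$, root $O$, and a map $\Pi:\mathcal V_{\vec N}\to\mathbb Z_+^d$ such that $\Pi(O)=\vec N$ and each vertex $Y$ with $\Pi(Y)=(n_1,\dots,n_d)$ has exactly one child $Y_{(ch),l}$ for every $l\in ch(Y):=\{i:n_i>0\}$, with $\Pi(Y_{(ch),l})=\Pi(Y)-\vec e_l$. (It is obtained by untwining all lattice paths from $\vec N$ to $\vec 0$ that decrease one coordinate by 1 at each step.) For $Y\ne O$, $Y_{(p)}$ is the parent of $Y$, and $\ell_Y\in\{1,\dots,d\}$ is the index with $\Pi(Y_{(p)})=\Pi(Y)+\vec e_{\ell_Y}$. Operator: set $V_Y:=b_{\Pi(Y),\ell_Y}$, $W_Y:=a_{\Pi(Y_{(p)}),\ell_Y}$ for $Y\ne O$, and $V_O:=\sum_{j=1}^d\kappa_jb_{\vec N,j}$, $W_O:=1$. The symmetric operator $\mathcal J_{\vec\kappa,\vec N}$ on $\ell^2(\mathcal V_{\vec N})$ is $$(\mathcal J_{\vec\kappa,\vec N}f)_Y=W_Y^{1/2}f_{Y_{(p)}}+V_Yf_Y+\sum_{l\in ch(Y)}W_{Y_{(ch),l}}^{1/2}f_{Y_{(ch),l}}\ (Y\neq O),\qquad (\mathcal J_{\vec\kappa,\vec N}f)_O=V_Of_O+\sum_{l\in ch(O)}W_{O_{(ch),l}}^{1/2}f_{O_{(ch),l}}.$$ Also $m_Y:=\prod_{y\in\mathrm{path}(Y,O)}W_y^{-1/2}$,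 the product over the non-self-intersecting path from $Y$ to $O$ including both endpoints. $e_X$ is the function equal to $1$ at the vertex $X$ and $0$ at all other vertices; $\sigma(\cdot)$ is the spectrum. *)

theory Defs
  imports "HOL-Analysis.Analysis" "HOL-Computational_Algebra.Polynomial"
begin

section \<open>Multi-indices and measures\<close>

text \<open>The index set \<open>{1,\<dots>,d}\<close> is a finite type \<open>'d\<close>, so that \<open>d = CARD('d) \<ge> 1\<close>;
  multi-indices in \<open>\<int>\<^sub>+\<^sup>d\<close> are functions \<open>'d \<Rightarrow> nat\<close>.\<close>

type_synonym 'd mindex = "'d \<Rightarrow> nat"

definition mabs :: "('d::finite) mindex \<Rightarrow> nat" where
  "mabs n = (\<Sum>i\<in>UNIV. n i)"

definition up :: "'d mindex \<Rightarrow> 'd \<Rightarrow> 'd mindex" where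
  "up n j = n(j := n j + 1)"

text \<open>Truncated at \<open>0\<close>; only used where \<open>n l > 0\<close>.\<close>

definition down :: "'d mindex \<Rightarrow> 'd \<Rightarrow> 'd mindex" where
  "down n l = n(l := n l - 1)"

definition positive_mindex :: "'d mindex \<Rightarrow> bool" where
  "positive_mindex n \<longleftrightarrow> (\<forall>i. n i \<ge> 1)"

definition measure_support :: "real measure \<Rightarrow> real set" where
  "measure_support M = {x. \<forall>U. open U \<and> x \<in> U \<longrightarrow> emeasure M U > 0}"

definition moment_measure :: "real measure \<Rightarrow> bool" where
  "moment_measure M \<longleftrightarrow>
     sets M = sets borel \<and> finite_measure M \<and> infinite (measure_support M) \<and>
     (\<forall>k::nat. integrable M (\<lambda>x. x ^ k))"

section \<open>Type II multiple orthogonal polynomials\<close>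

definition type_II :: "('d::finite \<Rightarrow> real measure) \<Rightarrow> 'd mindex \<Rightarrow> real poly \<Rightarrow> bool" where
  "type_II \<mu> n P \<longleftrightarrow>
     P \<noteq> 0 \<and> degree P \<le> mabs n \<and>
     (\<forall>j. \<forall>l < n j. (\<integral>x. poly P x * x ^ l \<partial>\<mu> j) = 0)"

text \<open>The degree clause is what makes the normalization ``monic of degree \<open>mabs n\<close>'' possible.
  It does not follow from uniqueness at the single index \<open>n\<close>: for \<open>d = 2\<close>, \<open>n = (1,1)\<close> and two
  probability measures with mean \<open>0\<close> and different variances, the solutions are exactly the
  nonzero multiples of \<open>x\<close>.\<close>

definition normal_index :: "('d::finite \<Rightarrow> real measure) \<Rightarrow> 'd mindex \<Rightarrow> bool" where
  "normal_index \<mu> n \<longleftrightarrow>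
     (\<forall>P Q. type_II \<mu> n P \<longrightarrow> type_II \<mu> n Q \<longrightarrow> (\<exists>c. Q = smult c P)) \<and>
     (\<exists>P. type_II \<mu> n P \<and> degree P = mabs n)"

definition perfect :: "('d::finite \<Rightarrow> real measure) \<Rightarrow> bool" where
  "perfect \<mu> \<longleftrightarrow> (\<forall>n. normal_index \<mu> n)"

definition mop :: "('d::finite \<Rightarrow> real measure) \<Rightarrow> 'd mindex \<Rightarrow> real poly" where
  "mop \<mu> n = (THE P. type_II \<mu> n P \<and> degree P = mabs n \<and> lead_coeff P = 1)"

definition nn_recurrence ::
  "('d::finite \<Rightarrow> real measure) \<Rightarrow> ('d mindex \<Rightarrow> 'd \<Rightarrow> real) \<Rightarrow> ('d mindex \<Rightarrow> 'd \<Rightarrow> real) \<Rightarrow> bool" where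
  "nn_recurrence \<mu> a b \<longleftrightarrow>
     (\<forall>n j. \<forall>x. x * poly (mop \<mu> n) x =
        poly (mop \<mu> (up n j)) x + b n j * poly (mop \<mu> n) x +
        (\<Sum>l | n l > 0. a n l * poly (mop \<mu> (down n l)) x)) \<and>
     (\<forall>n l. n l = 0 \<longrightarrow> a n l = 0)"

definition rec_coeffs ::
  "('d::finite \<Rightarrow> real measure) \<Rightarrow> ('d mindex \<Rightarrow> 'd \<Rightarrow> real) \<times> ('d mindex \<Rightarrow> 'd \<Rightarrow> real)" where
  "rec_coeffs \<mu> = (THE ab. nn_recurrence \<mu> (fst ab) (snd ab))"

definition rec_a :: "('d::finite \<Rightarrow> real measure) \<Rightarrow> 'd mindex \<Rightarrow> 'd \<Rightarrow> real" where
  "rec_a \<mu> = fst (rec_coeffs \<mu>)"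

definition rec_b :: "('d::finite \<Rightarrow> real measure) \<Rightarrow> 'd mindex \<Rightarrow> 'd \<Rightarrow> real" where
  "rec_b \<mu> = snd (rec_coeffs \<mu>)"

definition cond_A :: "('d::finite \<Rightarrow> real measure) \<Rightarrow> bool" where
  "cond_A \<mu> \<longleftrightarrow> perfect \<mu>"

definition cond_B :: "('d::finite \<Rightarrow> real measure) \<Rightarrow> bool" where
  "cond_B \<mu> \<longleftrightarrow> (\<forall>n j. n j > 0 \<longrightarrow> rec_a \<mu> n j > 0)"

definition cond_C :: "('d::finite \<Rightarrow> real measure) \<Rightarrow> bool" where
  "cond_C \<mu> \<longleftrightarrow>
     bdd_above {rec_a \<mu> n j | n j. positive_mindex n} \<and>
     bdd_above {\<bar>rec_b \<mu> n j\<bar> | n j. positive_mindex n}"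

section \<open>The finite tree\<close>

text \<open>A vertex is the list of edge labels met on the way from the vertex up to the root: the root
  is \<open>[]\<close>, the child of \<open>Y\<close> in direction \<open>l\<close> is \<open>l # Y\<close>, and for \<open>Y \<noteq> []\<close> the parent is \<open>tl Y\<close> and
  the label \<open>\<ell>\<^sub>Y\<close> is \<open>hd Y\<close>.\<close>

type_synonym 'd vertex = "'d list"

primrec proj :: "'d mindex \<Rightarrow> 'd vertex \<Rightarrow> 'd mindex" where
  "proj N [] = N"
| "proj N (l # Y) = down (proj N Y) l"

definition ch :: "'d mindex \<Rightarrow> 'd vertex \<Rightarrow> 'd set" where
  "ch N Y = {i. proj N Y i > 0}"

inductive_set vertices :: "'d mindex \<Rightarrow> 'd vertex set" for N :: "'d mindex" where
  root: "[] \<in> vertices N"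
| child: "Y \<in> vertices N \<Longrightarrow> l \<in> ch N Y \<Longrightarrow> l # Y \<in> vertices N"

definition path_to_root :: "'d vertex \<Rightarrow> 'd vertex set" where
  "path_to_root Y = {drop k Y | k. k \<le> length Y}"

section \<open>The Jacobi matrix\<close>

definition pot ::
  "('d::finite \<Rightarrow> real measure) \<Rightarrow> ('d \<Rightarrow> real) \<Rightarrow> 'd mindex \<Rightarrow> 'd vertex \<Rightarrow> real" where
  "pot \<mu> \<kappa> N Y =
     (if Y = [] then \<Sum>j\<in>UNIV. \<kappa> j * rec_b \<mu> N j else rec_b \<mu> (proj N Y) (hd Y))"

definition wgt :: "('d::finite \<Rightarrow> real measure) \<Rightarrow> 'd mindex \<Rightarrow> 'd vertex \<Rightarrow> real" where
  "wgt \<mu> N Y = (if Y = [] then 1 else rec_a \<mu> (proj N (tl Y)) (hd Y))"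

text \<open>\<open>\<ell>\<^sup>2(V)\<close> is represented by functions vanishing outside \<open>V\<close>.\<close>

definition ell2 :: "'v set \<Rightarrow> ('v \<Rightarrow> complex) set" where
  "ell2 V = {f. (\<forall>Y. Y \<notin> V \<longrightarrow> f Y = 0) \<and> (\<lambda>Y. (cmod (f Y))\<^sup>2) summable_on V}"

definition ell2_inner :: "'v set \<Rightarrow> ('v \<Rightarrow> complex) \<Rightarrow> ('v \<Rightarrow> complex) \<Rightarrow> complex" where
  "ell2_inner V f g = (\<Sum>\<^sub>\<infinity>Y\<in>V. f Y * cnj (g Y))"

definition basis_vec :: "'v \<Rightarrow> 'v \<Rightarrow> complex" where
  "basis_vec X = (\<lambda>Y. if Y = X then 1 else 0)"

definition jacobi ::
  "('d::finite \<Rightarrow> real measure) \<Rightarrow> ('d \<Rightarrow> real) \<Rightarrow> 'd mindex \<Rightarrow>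
   ('d vertex \<Rightarrow> complex) \<Rightarrow> ('d vertex \<Rightarrow> complex)" where
  "jacobi \<mu> \<kappa> N f = (\<lambda>Y.
     if Y \<in> vertices N then
       (if Y = [] then 0 else of_real (sqrt (wgt \<mu> N Y)) * f (tl Y)) +
       of_real (pot \<mu> \<kappa> N Y) * f Y +
       (\<Sum>l\<in>ch N Y. of_real (sqrt (wgt \<mu> N (l # Y))) * f (l # Y))
     else 0)"

definition shifted :: "(('v \<Rightarrow> complex) \<Rightarrow> ('v \<Rightarrow> complex)) \<Rightarrow> complex \<Rightarrow> ('v \<Rightarrow> complex) \<Rightarrow> ('v \<Rightarrow> complex)" where
  "shifted T z f = (\<lambda>Y. T f Y - z * f Y)"

text \<open>Spectrum and resolvent of an operator on \<open>\<ell>\<^sup>2(V)\<close> for finite \<open>V\<close>, where the inverse of a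
  bijective linear operator is automatically bounded.\<close>

definition op_spectrum :: "'v set \<Rightarrow> (('v \<Rightarrow> complex) \<Rightarrow> ('v \<Rightarrow> complex)) \<Rightarrow> complex set" where
  "op_spectrum V T = {z. \<not> bij_betw (shifted T z) (ell2 V) (ell2 V)}"

definition resolvent ::
  "'v set \<Rightarrow> (('v \<Rightarrow> complex) \<Rightarrow> ('v \<Rightarrow> complex)) \<Rightarrow> complex \<Rightarrow> ('v \<Rightarrow> complex) \<Rightarrow> ('v \<Rightarrow> complex)" where
  "resolvent V T z = inv_into (ell2 V) (shifted T z)"

definition green ::
  "('d::finite \<Rightarrow> real measure) \<Rightarrow> ('d \<Rightarrow> real) \<Rightarrow> 'd mindex \<Rightarrow> 'd vertex \<Rightarrow> 'd vertex \<Rightarrow> complex \<Rightarrow> complex" where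
  "green \<mu> \<kappa> N Y X z =
     ell2_inner (vertices N)
       (resolvent (vertices N) (jacobi \<mu> \<kappa> N) z (basis_vec X)) (basis_vec Y)"

definition mfun :: "('d::finite \<Rightarrow> real measure) \<Rightarrow> 'd mindex \<Rightarrow> 'd vertex \<Rightarrow> real" where
  "mfun \<mu> N Y = (\<Prod>y\<in>path_to_root Y. 1 / sqrt (wgt \<mu> N y))"

definition cpoly :: "real poly \<Rightarrow> complex \<Rightarrow> complex" where
  "cpoly P z = poly (map_poly complex_of_real P) z"

end

(* The nearest-neighbour recurrence says exactly that f_Y = m_Y^(-1) P_(Pi(Y))(z) satisfies
   (J - z) f = -S e_O, where S is the sum of kappa_j P_(N + e_j)(z): the weights m_Y turn the
   non-symmetric recurrence into the symmetric matrix J.  Since f does not vanish at the leaves of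
   the tree, injectivity of J - z forces S to be nonzero, and then (J - z)^(-1) e_O = -f / S. *)

theory Submission
  imports Defs
begin

section \<open>Polynomials and moments\<close>

lemma cpoly_add: "cpoly (p + q) z = cpoly p z + cpoly q z"
proof -
  have "map_poly complex_of_real (p + q) = map_poly of_real p + map_poly of_real q"
    by (rule poly_eqI) (simp add: coeff_map_poly)
  then show ?thesis by (simp add: cpoly_def)
qed

lemma cpoly_smult: "cpoly (smult c p) z = of_real c * cpoly p z"
proof -
  have "map_poly complex_of_real (smult c p) = smult (of_real c) (map_poly of_real p)"
    by (rule poly_eqI) (simp add: coeff_map_poly)
  then show ?thesis by (simp add: cpoly_def)
qed

lemma cpoly_0: "cpoly 0 z = 0"
  by (simp add: cpoly_def)

lemma cpoly_1: "cpoly 1 z = 1"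
  by (simp add: cpoly_def)

lemma cpoly_mult_X: "cpoly (pCons 0 p) z = z * cpoly p z"
  by (cases "p = 0") (simp_all add: cpoly_def map_poly_pCons)

lemma cpoly_sum: "cpoly (\<Sum>i\<in>A. p i) z = (\<Sum>i\<in>A. cpoly (p i) z)"
  by (induction A rule: infinite_finite_induct) (simp_all add: cpoly_0 cpoly_add)

section \<open>Moment functionals of a measure\<close>

text \<open>With the power as a separate index, orthogonality is the vanishing of numbers linear in
  \<open>p\<close>, and multiplying \<open>p\<close> by the variable merely shifts
  \<open>k\<close>.\<close>

definition pairing :: "real measure \<Rightarrow> nat \<Rightarrow> real poly \<Rightarrow> real" where
  "pairing M k p = (\<integral>x. poly p x * x ^ k \<partial>M)"

lemma integrable_poly_times_power:
  assumes "moment_measure M"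
  shows "integrable M (\<lambda>x. poly p x * x ^ k)"
proof -
  have "integrable M (\<lambda>x. \<Sum>i\<le>degree p. coeff p i * x ^ (i + k))"
    using assms unfolding moment_measure_def by (intro Bochner_Integration.integrable_sum) simp
  then show ?thesis
    by (simp add: poly_altdef sum_distrib_right power_add mult.assoc)
qed

text \<open>Integrability matters here: the integral of a non-integrable function is 0 by default,
  which would break additivity.\<close>

lemma pairing_add:
  assumes "moment_measure M"
  shows "pairing M k (p + q) = pairing M k p + pairing M k q"
  unfolding pairing_def
  using Bochner_Integration.integral_add[OF integrable_poly_times_power[OF assms]
      integrable_poly_times_power[OF assms], of p k q k]
  by (simp add: algebra_simps)

lemma pairing_smult: "pairing M k (smult c p) = c * pairing M k p"
  by (simp add: pairing_def mult.assoc)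

lemma pairing_0: "pairing M k 0 = 0"
  by (simp add: pairing_def)

lemma pairing_diff:
  assumes "moment_measure M"
  shows "pairing M k (p - q) = pairing M k p - pairing M k q"
  using pairing_add[OF assms, of k "p - q" q] by simp

lemma pairing_sum:
  assumes "moment_measure M"
  shows "pairing M k (\<Sum>i\<in>A. p i) = (\<Sum>i\<in>A. pairing M k (p i))"
  by (induction A rule: infinite_finite_induct) (simp_all add: pairing_0 pairing_add[OF assms])

lemma pairing_mult_X: "pairing M k (pCons 0 p) = pairing M (Suc k) p"
  by (simp add: pairing_def algebra_simps)

lemma type_II_pairing:
  "type_II \<mu> n P \<longleftrightarrow>
     P \<noteq> 0 \<and> degree P \<le> mabs n \<and> (\<forall>j. \<forall>l < n j. pairing (\<mu> j) l P = 0)"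
  by (simp add: type_II_def pairing_def)

section \<open>Nearest-neighbour recurrences\<close>

lemma mabs_up: "mabs (up n j) = Suc (mabs n)"
proof -
  have "mabs (up n j) = (n j + 1) + (\<Sum>i\<in>UNIV - {j}. n i)"
    unfolding mabs_def up_def by (subst sum.remove[of _ j]) auto
  also have "\<dots> = Suc (mabs n)"
    unfolding mabs_def by (subst sum.remove[of _ j]) auto
  finally show ?thesis .
qed

lemma up_down: "n l > 0 \<Longrightarrow> up (down n l) l = n"
  by (auto simp: up_def down_def fun_eq_iff)

lemma mabs_down: "n l > 0 \<Longrightarrow> Suc (mabs (down n l)) = mabs n"
  using mabs_up[of "down n l" l] by (simp add: up_down)

context
  fixes \<mu> :: "'d::finite \<Rightarrow> real measure"
  assumes moments: "\<And>j. moment_measure (\<mu> j)"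
    and perf: "perfect \<mu>"
begin

section \<open>Consequences of normality\<close>

text \<open>Were \<open>Q\<close> nonzero, normality would make a type II polynomial of full degree
  a multiple of \<open>Q\<close>, and its leading coefficient would be 0. This is the tool for
  proving polynomial identities below.\<close>

lemma type_II_coeff_eq_0:
  assumes "degree Q \<le> mabs n" "coeff Q (mabs n) = 0"
    and "\<And>j l. l < n j \<Longrightarrow> pairing (\<mu> j) l Q = 0"
  shows "Q = 0"
proof (rule ccontr)
  assume "Q \<noteq> 0"
  with assms have Q: "type_II \<mu> n Q" by (auto simp: type_II_pairing)
  have "normal_index \<mu> n" using perf by (simp add: perfect_def)
  then obtain P c where P: "type_II \<mu> n P" "degree P = mabs n" "P = smult c Q"
    using Q unfolding normal_index_def by blast
  then have "lead_coeff P = 0" using assms(2) by simp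
  with P(1) show False by (simp add: type_II_def)
qed

text \<open>Justifies the definite description in \<open>mop\<close>: dividing by the leading
  coefficient gives existence, and proportional monic polynomials coincide.\<close>

lemma mop_spec: "type_II \<mu> n (mop \<mu> n) \<and> degree (mop \<mu> n) = mabs n \<and> lead_coeff (mop \<mu> n) = 1"
  unfolding mop_def
proof (rule theI')
  let ?P = "\<lambda>P. type_II \<mu> n P \<and> degree P = mabs n \<and> lead_coeff P = 1"
  have normal: "normal_index \<mu> n" using perf by (simp add: perfect_def)
  then obtain P where P: "type_II \<mu> n P" "degree P = mabs n"
    unfolding normal_index_def by blast
  then have "lead_coeff P \<noteq> 0" unfolding type_II_def leading_coeff_0_iff by blast
  then have "?P (smult (inverse (lead_coeff P)) P)"
    using P by (auto simp: type_II_pairing pairing_smult)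
  moreover have "Q = R" if QR: "?P Q" "?P R" for Q R
  proof -
    obtain c where c: "R = smult c Q" using QR normal unfolding normal_index_def by blast
    then have "coeff R (mabs n) = c * coeff Q (mabs n)" by simp
    then have "c = 1" using QR by (metis mult_1_right)
    then show ?thesis using c by simp
  qed
  ultimately show "\<exists>!P. ?P P" by blast
qed

lemma coeff_mop_mabs: "coeff (mop \<mu> n) (mabs n) = 1"
  using mop_spec[of n] by metis

lemma coeff_mop_above: "mabs n < i \<Longrightarrow> coeff (mop \<mu> n) i = 0"
  using mop_spec[of n] by (simp add: coeff_eq_0)

lemma pairing_mop: "l < n j \<Longrightarrow> pairing (\<mu> j) l (mop \<mu> n) = 0"
  using mop_spec[of n] by (simp add: type_II_pairing)

lemma mop_zero: "mop \<mu> (\<lambda>_. 0) = 1"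
proof -
  have "degree (mop \<mu> (\<lambda>_. 0)) = 0" "lead_coeff (mop \<mu> (\<lambda>_. 0)) = 1"
    using mop_spec[of "\<lambda>_. 0"] by (auto simp: mabs_def)
  then show ?thesis by (auto elim!: degree_eq_zeroE)
qed

text \<open>Otherwise the polynomial at \<open>down n l\<close> would satisfy every orthogonality
  relation of \<open>n\<close> with degree below \<open>mabs n\<close>, hence vanish. This makes the
  denominators in \<open>nn_a\<close> legitimate.\<close>

lemma pairing_mop_down_neq_0:
  assumes "n l > 0"
  shows "pairing (\<mu> l) (n l - 1) (mop \<mu> (down n l)) \<noteq> 0"
proof
  let ?P = "mop \<mu> (down n l)"
  assume zero: "pairing (\<mu> l) (n l - 1) ?P = 0"
  have deg: "mabs (down n l) < mabs n" using mabs_down[of n l] assms by simp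
  have "?P = 0"
  proof (rule type_II_coeff_eq_0[of _ n])
    show "degree ?P \<le> mabs n" using deg mop_spec[of "down n l"] by simp
    show "coeff ?P (mabs n) = 0" using deg by (rule coeff_mop_above)
    show "pairing (\<mu> j) i ?P = 0" if "i < n j" for j i
    \<comment> \<open>This is the only relation required at \<open>n\<close> but not at
      \<open>down n l\<close>.\<close>
    proof (cases "j = l \<and> i = n l - 1")
      case True
      then show ?thesis using zero by simp
    next
      case False
      then have "i < down n l j" using that by (auto simp: down_def)
      then show ?thesis by (rule pairing_mop)
    qed
  qed
  then show False using mop_spec[of "down n l"] by (simp add: type_II_def)
qed

section \<open>Existence and uniqueness of the recurrence coefficients\<close>

text \<open>Read off by comparing coefficients at \<open>mabs n\<close>, a degree that the
  polynomials at \<open>down n l\<close> do not reach.\<close>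

definition nn_b :: "'d mindex \<Rightarrow> 'd \<Rightarrow> real" where
  "nn_b n j = coeff (pCons 0 (mop \<mu> n) - mop \<mu> (up n j)) (mabs n)"

text \<open>Read off by pairing the recurrence with the power \<open>n l - 1\<close> under
  \<open>\<mu> l\<close>: on the right only the term of \<open>down n l\<close> survives.\<close>

definition nn_a :: "'d mindex \<Rightarrow> 'd \<Rightarrow> real" where
  "nn_a n l = (if n l = 0 then 0 else
     pairing (\<mu> l) (n l) (mop \<mu> n) / pairing (\<mu> l) (n l - 1) (mop \<mu> (down n l)))"

text \<open>Agreement at all real points is equality of polynomials; in this form the recurrence can
  be paired, compared by coefficients and evaluated at complex points.\<close>

lemma nn_recurrence_poly_iff:
  "nn_recurrence \<mu> a b \<longleftrightarrow>
     (\<forall>n j. pCons 0 (mop \<mu> n) =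
        mop \<mu> (up n j) + smult (b n j) (mop \<mu> n) +
        (\<Sum>l | n l > 0. smult (a n l) (mop \<mu> (down n l)))) \<and>
     (\<forall>n l. n l = 0 \<longrightarrow> a n l = 0)"
  unfolding nn_recurrence_def
  by (simp add: poly_eq_poly_eq_iff[symmetric] fun_eq_iff poly_sum)

text \<open>Lowering \<open>n\<close> at \<open>l\<close> loses a single orthogonality relation,
  under \<open>\<mu> l\<close> at power \<open>n l - 1\<close>, so at most the term
  \<open>l = k\<close> contributes.\<close>

lemma pairing_sum_mop_down:
  assumes "i < n k"
  shows "pairing (\<mu> k) i (\<Sum>l | n l > 0. smult (c l) (mop \<mu> (down n l))) =
    (if Suc i = n k then c k * pairing (\<mu> k) (n k - 1) (mop \<mu> (down n k)) else 0)"
proof -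
  have "pairing (\<mu> k) i (\<Sum>l | n l > 0. smult (c l) (mop \<mu> (down n l))) =
      (\<Sum>l | n l > 0. c l * pairing (\<mu> k) i (mop \<mu> (down n l)))"
    by (simp add: pairing_sum[OF moments] pairing_smult)
  also have "\<dots> = (\<Sum>l | n l > 0. if l = k then
      (if Suc i = n k then c k * pairing (\<mu> k) (n k - 1) (mop \<mu> (down n k)) else 0) else 0)"
  proof (rule sum.cong[OF refl])
    fix l assume "l \<in> {l. n l > 0}"
    show "c l * pairing (\<mu> k) i (mop \<mu> (down n l)) = (if l = k then
      (if Suc i = n k then c k * pairing (\<mu> k) (n k - 1) (mop \<mu> (down n k)) else 0) else 0)"
    proof (cases "l = k \<and> Suc i = n k")
      case True
      then have "i = n k - 1" by linarith
      with True show ?thesis by simp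
    next
      case False
      then have "i < down n l k" using assms by (auto simp: down_def)
      then show ?thesis using False by (auto simp: pairing_mop)
    qed
  qed
  also have "\<dots> = (if Suc i = n k then c k * pairing (\<mu> k) (n k - 1) (mop \<mu> (down n k)) else 0)"
    using assms by (subst sum.delta) auto
  finally show ?thesis .
qed

lemma coeff_sum_mop_down:
  assumes "i \<ge> mabs n"
  shows "coeff (\<Sum>l | n l > 0. smult (c l) (mop \<mu> (down n l))) i = 0"
proof -
  have "coeff (mop \<mu> (down n l)) i = 0" if "n l > 0" for l
    using mabs_down[of n l] that assms by (intro coeff_mop_above) simp
  then show ?thesis by (simp add: coeff_sum)
qed

text \<open>\<open>nn_a\<close> does not depend on \<open>j\<close>: neither \<open>mop \<mu> (up n j)\<close> nor \<open>mop \<mu> n\<close> contributes when the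
  recurrence is integrated against \<open>x ^ (n l - 1)\<close> with respect to \<open>\<mu> l\<close>.\<close>

lemma nn_recurrence_nn_a_nn_b: "nn_recurrence \<mu> nn_a nn_b"
  unfolding nn_recurrence_poly_iff
proof (intro conjI allI impI)
  fix n :: "'d mindex" and j :: 'd
  let ?D = "\<Sum>l | n l > 0. smult (nn_a n l) (mop \<mu> (down n l))"
  \<comment> \<open>The defect of the recurrence: its terms of degree \<open>mabs n + 1\<close>
    cancel, \<open>nn_b\<close> removes the coefficient at \<open>mabs n\<close>, and
    \<open>nn_a\<close> restores orthogonality.\<close>
  let ?R = "pCons 0 (mop \<mu> n) - mop \<mu> (up n j) - smult (nn_b n j) (mop \<mu> n) - ?D"
  have "?R = 0"
  proof (rule type_II_coeff_eq_0[of _ n])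
    show "degree ?R \<le> mabs n"
    proof (rule degree_le, intro allI impI)
      fix i assume i: "mabs n < i"
      then obtain i' where i': "i = Suc i'" by (cases i) auto
      have D: "coeff ?D i = 0" using i by (intro coeff_sum_mop_down) simp
      have "coeff (mop \<mu> n) i' = coeff (mop \<mu> (up n j)) i"
      proof (cases "i' = mabs n")
        case True
        then show ?thesis
          using i' coeff_mop_mabs[of n] coeff_mop_mabs[of "up n j"] by (simp add: mabs_up)
      next
        case False
        then show ?thesis using i i' by (simp add: coeff_mop_above mabs_up)
      qed
      then show "coeff ?R i = 0" using i i' D by (simp add: coeff_mop_above)
    qed
    have "coeff ?D (mabs n) = 0" by (rule coeff_sum_mop_down) simp
    then show "coeff ?R (mabs n) = 0"
      by (simp add: coeff_mop_mabs nn_b_def)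
    show "pairing (\<mu> k) i ?R = 0" if i: "i < n k" for k i
    proof -
      have "i < up n j k" using i by (auto simp: up_def)
      then have "pairing (\<mu> k) i ?R = pairing (\<mu> k) (Suc i) (mop \<mu> n) - pairing (\<mu> k) i ?D"
        using i by (simp add: pairing_diff[OF moments] pairing_smult pairing_mult_X pairing_mop)
      also have "\<dots> = 0"
      proof (cases "Suc i = n k")
        \<comment> \<open>Only at this power can the shifted pairing of \<open>mop \<mu> n\<close>
          be nonzero; \<open>nn_a\<close> is the quotient that balances it.\<close>
        case True
        then show ?thesis
          using i pairing_mop_down_neq_0[of n k]
          by (simp add: pairing_sum_mop_down nn_a_def)
      next
        case False
        then have "Suc i < n k" using i by simp
        then show ?thesis using i by (simp add: pairing_sum_mop_down pairing_mop)
      qed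
      finally show ?thesis .
    qed
  qed
  then show "pCons 0 (mop \<mu> n) = mop \<mu> (up n j) + smult (nn_b n j) (mop \<mu> n) + ?D"
    by (simp add: algebra_simps)
qed (simp add: nn_a_def)

lemma nn_recurrence_unique:
  assumes "nn_recurrence \<mu> a b"
  shows "a = nn_a" "b = nn_b"
proof -
  have rec: "pCons 0 (mop \<mu> n) = mop \<mu> (up n j) + smult (b n j) (mop \<mu> n) +
        (\<Sum>l | n l > 0. smult (a n l) (mop \<mu> (down n l)))" for n j
    using assms by (simp add: nn_recurrence_poly_iff)
  have "b n j = nn_b n j" for n j
    unfolding nn_b_def
    by (subst rec[of n j]) (simp add: coeff_mop_mabs coeff_sum_mop_down del: coeff_sum)
  then show "b = nn_b" by (simp add: fun_eq_iff)
  have "a n l = nn_a n l" for n l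
  proof (cases "n l = 0")
    case True
    then show ?thesis using assms by (simp add: nn_a_def nn_recurrence_poly_iff)
  next
    case False
    have "pairing (\<mu> l) (n l) (mop \<mu> n) = pairing (\<mu> l) (n l - 1) (pCons 0 (mop \<mu> n))"
      using False by (simp add: pairing_mult_X)
    also have "\<dots> = a n l * pairing (\<mu> l) (n l - 1) (mop \<mu> (down n l))"
      using False
      by (subst rec[of n l])
        (simp add: pairing_add[OF moments] pairing_smult pairing_mop pairing_sum_mop_down up_def)
    finally show ?thesis using False pairing_mop_down_neq_0[of n l] by (simp add: nn_a_def)
  qed
  then show "a = nn_a" by (simp add: fun_eq_iff)
qed

text \<open>Existence and uniqueness together make the definite description in
  \<open>rec_coeffs\<close> meaningful.\<close>

lemma nn_recurrence_rec: "nn_recurrence \<mu> (rec_a \<mu>) (rec_b \<mu>)"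
proof -
  have "nn_recurrence \<mu> (fst (rec_coeffs \<mu>)) (snd (rec_coeffs \<mu>))"
    unfolding rec_coeffs_def
  proof (rule theI[of _ "(nn_a, nn_b)"])
    show "nn_recurrence \<mu> (fst (nn_a, nn_b)) (snd (nn_a, nn_b))"
      using nn_recurrence_nn_a_nn_b by simp
    show "ab = (nn_a, nn_b)" if "nn_recurrence \<mu> (fst ab) (snd ab)" for ab
      using nn_recurrence_unique[OF that] by (simp add: prod_eq_iff)
  qed
  then show ?thesis by (simp add: rec_a_def rec_b_def)
qed

lemma cpoly_mop_recurrence:
  "z * cpoly (mop \<mu> n) z =
     cpoly (mop \<mu> (up n j)) z + of_real (rec_b \<mu> n j) * cpoly (mop \<mu> n) z +
     (\<Sum>l | n l > 0. of_real (rec_a \<mu> n l) * cpoly (mop \<mu> (down n l)) z)"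
proof -
  have "pCons 0 (mop \<mu> n) = mop \<mu> (up n j) + smult (rec_b \<mu> n j) (mop \<mu> n) +
      (\<Sum>l | n l > 0. smult (rec_a \<mu> n l) (mop \<mu> (down n l)))"
    using nn_recurrence_rec unfolding nn_recurrence_poly_iff by blast
  from arg_cong[OF this, of "\<lambda>p. cpoly p z"] show ?thesis
    by (simp add: cpoly_add cpoly_smult cpoly_mult_X cpoly_sum)
qed

end

section \<open>The finite tree\<close>

text \<open>Each edge lowers one positive coordinate by 1. The resulting bound on the depth makes
  the tree finite.\<close>

lemma length_vertex:
  fixes N :: "'d::finite mindex"
  assumes "Y \<in> vertices N"
  shows "length Y + mabs (proj N Y) = mabs N"
  using assms by induction (simp_all add: ch_def mabs_down[symmetric])

lemma finite_vertices: "finite (vertices (N :: 'd::finite mindex))"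
proof (rule finite_subset)
  show "vertices N \<subseteq> {Y. set Y \<subseteq> UNIV \<and> length Y \<le> mabs N}"
    using length_vertex[of _ N] by fastforce
qed (rule finite_lists_length_le, simp)

lemma vertex_Cons_iff: "l # Y \<in> vertices N \<longleftrightarrow> Y \<in> vertices N \<and> l \<in> ch N Y"
  by (auto elim: vertices.cases intro: vertices.child)

text \<open>Descend as long as some coordinate is positive; \<open>mabs\<close> of the projection
  drops at every step.\<close>

lemma leaf_exists:
  fixes N :: "'d::finite mindex"
  obtains Y where "Y \<in> vertices N" "proj N Y = (\<lambda>_. 0)"
proof -
  have "\<exists>Y'. Y' \<in> vertices N \<and> proj N Y' = (\<lambda>_. 0)" if "Y \<in> vertices N" for Y
    using that
  proof (induction "mabs (proj N Y)" arbitrary: Y rule: less_induct)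
    case less
    show ?case
    proof (cases "ch N Y = {}")
      case True
      then have "proj N Y = (\<lambda>_. 0)" by (auto simp: ch_def)
      then show ?thesis using less.prems by blast
    next
      case False
      then obtain l where l: "l \<in> ch N Y" by blast
      then have "mabs (proj N (l # Y)) < mabs (proj N Y)"
        using mabs_down[of "proj N Y" l] by (simp add: ch_def)
      moreover have "l # Y \<in> vertices N" using less.prems l by (rule vertices.child)
      ultimately show ?thesis by (rule less.hyps)
    qed
  qed
  from this[OF vertices.root] show ?thesis using that by blast
qed

section \<open>Path products and positivity of the weights\<close>

lemma path_to_root_Nil: "path_to_root [] = {[]}"
  by (auto simp: path_to_root_def)

lemma path_to_root_Cons: "path_to_root (l # Y) = insert (l # Y) (path_to_root Y)"
proof -
  have *: "path_to_root Z = (\<lambda>k. drop k Z) ` {..length Z}" for Z :: "'a list"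
    by (auto simp: path_to_root_def)
  show ?thesis
    unfolding * by (simp add: atMost_Suc_eq_insert_0 image_image)
qed

lemma inverse_mfun_Nil: "inverse (mfun \<mu> N []) = 1"
  by (simp add: mfun_def path_to_root_Nil wgt_def)

text \<open>The path of a child has exactly one new vertex, absent from the path of \<open>Y\<close>
  because it is longer than every suffix of \<open>Y\<close>.\<close>

lemma inverse_mfun_Cons:
  "inverse (mfun \<mu> N (l # Y)) = sqrt (wgt \<mu> N (l # Y)) * inverse (mfun \<mu> N Y)"
proof -
  have "length Z \<le> length Y" if "Z \<in> path_to_root Y" for Z
    using that by (auto simp: path_to_root_def)
  then have "l # Y \<notin> path_to_root Y" by fastforce
  moreover have "path_to_root Y = (\<lambda>k. drop k Y) ` {..length Y}"
    by (auto simp: path_to_root_def)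
  then have "finite (path_to_root Y)" by simp
  ultimately show ?thesis by (simp add: mfun_def path_to_root_Cons divide_inverse)
qed

text \<open>An edge in direction \<open>l\<close> exists only where the coordinate \<open>l\<close>
  of the parent is positive, which is where \<open>cond_B\<close> applies; the root has weight
  1.\<close>

lemma wgt_pos:
  assumes "cond_B \<mu>" "Y \<in> vertices N"
  shows "wgt \<mu> N Y > 0"
  using assms(2,1) by cases (auto simp: wgt_def cond_B_def ch_def)

lemma inverse_mfun_pos:
  assumes "cond_B \<mu>" "Y \<in> vertices N"
  shows "inverse (mfun \<mu> N Y) > 0"
  using assms(2)
proof induction
  case root
  then show ?case by (simp only: inverse_mfun_Nil)
next
  case (child Y l)
  then show ?case
    using wgt_pos[OF assms(1) vertices.child[OF child(1,2)]]
    by (simp only: inverse_mfun_Cons) simp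
qed

lemma ell2_finite: "finite V \<Longrightarrow> ell2 V = {f. \<forall>Y. Y \<notin> V \<longrightarrow> f Y = 0}"
  by (auto simp: ell2_def)

lemma ell2_inner_basis_vec:
  assumes "finite V" "X \<in> V"
  shows "ell2_inner V f (basis_vec X) = f X"
  using assms by (simp add: ell2_inner_def basis_vec_def if_distrib mult_delta_right cong: if_cong)

section \<open>The Green's function\<close>

text \<open>The value 0 off the tree places it in \<open>ell2 (vertices N)\<close>.\<close>

definition tree_fun ::
  "('d::finite \<Rightarrow> real measure) \<Rightarrow> 'd mindex \<Rightarrow> complex \<Rightarrow> 'd vertex \<Rightarrow> complex" where
  "tree_fun \<mu> N z Y = (if Y \<in> vertices N
     then of_real (inverse (mfun \<mu> N Y)) * cpoly (mop \<mu> (proj N Y)) z else 0)"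

text \<open>The square root of a child's weight occurs once in the matrix and once in the inverse
  path product; together they give the coefficient \<open>rec_a\<close>.\<close>

lemma tree_fun_children:
  assumes "cond_B \<mu>" "Y \<in> vertices N"
  shows "(\<Sum>l\<in>ch N Y. of_real (sqrt (wgt \<mu> N (l # Y))) * tree_fun \<mu> N z (l # Y)) =
    of_real (inverse (mfun \<mu> N Y)) *
      (\<Sum>l | proj N Y l > 0. of_real (rec_a \<mu> (proj N Y) l) * cpoly (mop \<mu> (down (proj N Y) l)) z)"
  unfolding sum_distrib_left
proof (rule sum.cong)
  show "ch N Y = {l. proj N Y l > 0}" by (simp add: ch_def)
  fix l assume "l \<in> {l. proj N Y l > 0}"
  then have v: "l # Y \<in> vertices N" using assms(2) by (simp add: vertices.child ch_def)
  have "of_real (sqrt (wgt \<mu> N (l # Y))) * complex_of_real (inverse (mfun \<mu> N (l # Y))) =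
      of_real (sqrt (wgt \<mu> N (l # Y)) * sqrt (wgt \<mu> N (l # Y))) * of_real (inverse (mfun \<mu> N Y))"
    by (simp only: inverse_mfun_Cons of_real_mult mult.assoc)
  also have "sqrt (wgt \<mu> N (l # Y)) * sqrt (wgt \<mu> N (l # Y)) = rec_a \<mu> (proj N Y) l"
    using wgt_pos[OF assms(1) v] by (simp add: wgt_def)
  finally show "of_real (sqrt (wgt \<mu> N (l # Y))) * tree_fun \<mu> N z (l # Y) =
      of_real (inverse (mfun \<mu> N Y)) *
      (of_real (rec_a \<mu> (proj N Y) l) * cpoly (mop \<mu> (down (proj N Y) l)) z)"
    using v by (simp add: tree_fun_def del: of_real_inverse)
qed

text \<open>Away from the root this is the recurrence in the direction \<open>hd Y\<close>, whose
  raised term sits at the parent. The root has no parent, so the averaged raised terms are left over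
  there.\<close>

lemma shifted_jacobi_tree_fun:
  fixes \<mu> :: "'d::finite \<Rightarrow> real measure"
  assumes moments: "\<And>j. moment_measure (\<mu> j)"
    and "perfect \<mu>" and B: "cond_B \<mu>" and \<kappa>: "(\<Sum>j\<in>UNIV. \<kappa> j) = 1"
  shows "shifted (jacobi \<mu> \<kappa> N) z (tree_fun \<mu> N z) Y =
    - (\<Sum>j\<in>UNIV. of_real (\<kappa> j) * cpoly (mop \<mu> (up N j)) z) * basis_vec [] Y"
proof (cases "Y \<in> vertices N")
  case False
  then have "Y \<noteq> []" using vertices.root by auto
  then show ?thesis
    using False by (simp add: shifted_def jacobi_def tree_fun_def basis_vec_def)
next
  case True
  note recurrence = cpoly_mop_recurrence[OF moments \<open>perfect \<mu>\<close>]
  let ?p = "\<lambda>n. cpoly (mop \<mu> n) z"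
  let ?D = "\<lambda>n. \<Sum>l | n l > 0. of_real (rec_a \<mu> n l) * ?p (down n l)"
  show ?thesis
  proof (cases Y)
    case Nil
    \<comment> \<open>Average the recurrences at \<open>N\<close> over \<open>j\<close>: terms
      independent of \<open>j\<close> survive unchanged since the weights sum to 1, and
      \<open>rec_b\<close> averages to the potential at the root.\<close>
    have "(\<Sum>j\<in>UNIV. of_real (\<kappa> j) * (z * ?p N)) =
        (\<Sum>j\<in>UNIV. of_real (\<kappa> j) * (?p (up N j) + of_real (rec_b \<mu> N j) * ?p N + ?D N))"
      by (rule sum.cong[OF refl]) (subst recurrence, rule refl)
    moreover have "(\<Sum>j\<in>UNIV. complex_of_real (\<kappa> j)) = 1"
      using \<kappa> by (metis of_real_1 of_real_sum)
    then have "(\<Sum>j\<in>UNIV. complex_of_real (\<kappa> j) * c) = c" for c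
      by (simp add: sum_distrib_right[symmetric])
    ultimately have "z * ?p N = (\<Sum>j\<in>UNIV. of_real (\<kappa> j) * ?p (up N j)) +
        (\<Sum>j\<in>UNIV. of_real (\<kappa> j) * of_real (rec_b \<mu> N j)) * ?p N + ?D N"
      by (simp only: distrib_left sum.distrib sum_distrib_right mult.assoc)
    moreover have "tree_fun \<mu> N z [] = ?p N"
      using inverse_mfun_Nil[of \<mu> N] by (simp add: tree_fun_def vertices.root)
    ultimately show ?thesis
      using tree_fun_children[OF B, of "[]" N z] True inverse_mfun_Nil[of \<mu> N] Nil
      by (simp add: shifted_def jacobi_def basis_vec_def pot_def)
  next
    case (Cons l X)
    let ?n = "proj N Y" and ?m = "complex_of_real (inverse (mfun \<mu> N Y))"
    from True Cons have X: "X \<in> vertices N" "proj N X l > 0"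
      by (auto simp: vertex_Cons_iff ch_def)
    \<comment> \<open>The factor from the matrix is absorbed into the path product of
      \<open>Y\<close>, and raising the index of \<open>Y\<close> at \<open>l\<close> returns that
      of \<open>X\<close>.\<close>
    have parent: "of_real (sqrt (wgt \<mu> N Y)) * tree_fun \<mu> N z (tl Y) = ?m * ?p (up ?n l)"
      using X Cons by (simp add: tree_fun_def inverse_mfun_Cons up_down del: of_real_inverse)
    have "jacobi \<mu> \<kappa> N (tree_fun \<mu> N z) Y =
        ?m * ?p (up ?n l) + of_real (rec_b \<mu> ?n l) * (?m * ?p ?n) + ?m * ?D ?n"
      using parent tree_fun_children[OF B True, of z] True Cons
      by (simp add: jacobi_def pot_def tree_fun_def del: of_real_inverse)
    also have "\<dots> = ?m * (z * ?p ?n)"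
      unfolding recurrence[of z ?n l] by (simp only: distrib_left mult.left_commute)
    finally show ?thesis
      using True Cons by (simp add: shifted_def tree_fun_def basis_vec_def)
  qed
qed

section \<open>Inversion at the root vector\<close>

text \<open>Nonvanishing of the denominator belongs to the conclusion because division by 0 yields 0
  in HOL, so the formula alone would not express it.\<close>

theorem mainTheorem2:
  fixes \<mu> :: "'d::finite \<Rightarrow> real measure"
    and N :: "'d mindex"
    and \<kappa> :: "'d \<Rightarrow> real"
    and Y :: "'d vertex"
    and z :: complex
  assumes "\<And>j. moment_measure (\<mu> j)"
    and "cond_A \<mu>" and "cond_B \<mu>" and "cond_C \<mu>"
    and "positive_mindex N"
    and "(\<Sum>j\<in>UNIV. \<kappa> j) = 1"
    and "Y \<in> vertices N"
    and "z \<notin> op_spectrum (vertices N) (jacobi \<mu> \<kappa> N)"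
  shows "(\<Sum>j\<in>UNIV. of_real (\<kappa> j) * cpoly (mop \<mu> (up N j)) z) \<noteq> 0 \<and>
    green \<mu> \<kappa> N Y [] z =
      - (inverse (of_real (mfun \<mu> N Y)) * cpoly (mop \<mu> (proj N Y)) z /
         (\<Sum>j\<in>UNIV. of_real (\<kappa> j) * cpoly (mop \<mu> (up N j)) z))"
proof -
  let ?V = "vertices N" and ?T = "shifted (jacobi \<mu> \<kappa> N) z" and ?f = "tree_fun \<mu> N z"
  let ?S = "\<Sum>j\<in>UNIV. of_real (\<kappa> j) * cpoly (mop \<mu> (up N j)) z"
  have perf: "perfect \<mu>" using assms(2) by (simp add: cond_A_def)
  have inj: "inj_on ?T (ell2 ?V)"
    using assms(8) by (simp add: op_spectrum_def bij_betw_def)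
  have Tf: "?T ?f X = - ?S * basis_vec [] X" for X
    using assms(1) perf assms(3,6) by (rule shifted_jacobi_tree_fun)
  have f: "?f \<in> ell2 ?V" by (simp add: ell2_finite finite_vertices tree_fun_def)
  have "?S \<noteq> 0"
  proof
    assume S: "?S = 0"
    have zero: "?T (\<lambda>_. 0) X = 0" for X
      by (simp add: shifted_def jacobi_def)
    have "?T ?f X = ?T (\<lambda>_. 0) X" for X
      unfolding Tf zero S by simp
    then have "?T ?f = ?T (\<lambda>_. 0)" by blast
    moreover have "(\<lambda>_. 0) \<in> ell2 ?V" by (simp add: ell2_finite finite_vertices)
    ultimately have f0: "?f = (\<lambda>_. 0)" using inj f by (simp add: inj_on_eq_iff)
    obtain X where X: "X \<in> ?V" "proj N X = (\<lambda>_. 0)" by (rule leaf_exists)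
    \<comment> \<open>At a leaf the polynomial is the constant 1, so the value is nonzero whatever
      \<open>z\<close> is.\<close>
    have "?f X = of_real (inverse (mfun \<mu> N X))"
      using X mop_zero[OF assms(1) perf] by (simp add: tree_fun_def cpoly_1)
    then have "?f X \<noteq> 0" using inverse_mfun_pos[OF assms(3) X(1)] by auto
    then show False using f0 by simp
  qed
  have scale: "?T (\<lambda>X. c * ?f X) X = c * ?T ?f X" for c X
    by (simp add: shifted_def jacobi_def algebra_simps sum_distrib_left)
  have "?T (\<lambda>X. - inverse ?S * ?f X) X = basis_vec [] X" for X
    unfolding scale Tf using \<open>?S \<noteq> 0\<close> by simp
  then have "?T (\<lambda>X. - inverse ?S * ?f X) = basis_vec []" by blast
  moreover have "(\<lambda>X. - inverse ?S * ?f X) \<in> ell2 ?V"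
    by (simp add: ell2_finite finite_vertices tree_fun_def)
  \<comment> \<open>Since \<open>resolvent\<close> is an \<open>inv_into\<close> of an injective
    map, an explicit preimage in \<open>ell2 ?V\<close> determines its value.\<close>
  ultimately have "resolvent ?V (jacobi \<mu> \<kappa> N) z (basis_vec []) = (\<lambda>X. - inverse ?S * ?f X)"
    unfolding resolvent_def by (intro inv_into_f_eq[OF inj])
  then have "green \<mu> \<kappa> N Y [] z = - inverse ?S * ?f Y"
    using assms(7) by (simp add: green_def ell2_inner_basis_vec finite_vertices)
  with \<open>?S \<noteq> 0\<close> assms(7) show ?thesis
    by (simp add: tree_fun_def field_simps)
qed

end
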